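(* A universal function $F:2^\omega\times 2^\omega\to 2^\omega$ cannot be of Baire class 1.
   Context: A function $F:X\times X\to X$ is universal iff for every $G:X\times X\to X$ there is $g:X\to X$ with $G(x,y)=F(g(x),g(y))$ for all $x,y\in X$. A function $F:2^\omega\times 2^\omega\to 2^\omega$ is of Baire class $1$ iff the preimage of every clopen set is $\mathbf\Delta^0_2$. *)

theory Defs
  imports "HOL-Analysis.Analysis"
begin

definition universal :: "('a \<times> 'a \<Rightarrow> 'a) \<Rightarrow> bool" where
  "universal F \<longleftrightarrow>
     (\<forall>G :: 'a \<times> 'a \<Rightarrow> 'a. \<exists>g :: 'a \<Rightarrow> 'a. \<forall>x y. G (x, y) = F (g x, g y))"

text \<open>The Cantor space: the type class topology on \<^typ>\<open>nat \<Rightarrow> bool\<close> is the product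
  of the discrete topologies on \<^typ>\<open>bool\<close>.\<close>

type_synonym cantor = "nat \<Rightarrow> bool"

definition delta_0_2 :: "'a::topological_space set \<Rightarrow> bool" where
  "delta_0_2 A \<longleftrightarrow> fsigma A \<and> gdelta A"

definition baire_class_1 :: "(cantor \<times> cantor \<Rightarrow> cantor) \<Rightarrow> bool" where
  "baire_class_1 F \<longleftrightarrow> (\<forall>C. open C \<and> closed C \<longrightarrow> delta_0_2 (F -` C))"

end

theory Submission
  imports Defs
begin

text \<open>An uncountable set \<open>W\<close> carrying a linear order with countable initial segments yields a
  relation on \<open>W\<close> which, by universality, is reduced to a \<open>\<Delta>\<^sup>0\<^sub>2\<close> set \<open>D\<close> in the plane by
  a map \<open>g\<close>. Discard the countably many points of \<open>W\<close> that have a neighbourhood with countable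
  \<open>g\<close>-preimage in \<open>W\<close>, and let \<open>K\<close> be the closure of \<open>g ` Y \<times> g ` Y\<close> for the remaining set \<open>Y\<close>.
  By the Baire category theorem some open rectangle \<open>U \<times> V\<close> meets \<open>K\<close> in a nonempty set that
  lies inside \<open>D\<close> or is disjoint from it. But uncountably many points of \<open>Y\<close> are mapped to each of
  \<open>U\<close> and \<open>V\<close>, so the order relation both holds and fails on the rectangle.\<close>

text \<open>This makes \<open>cantor\<close>, a countable power of \<open>bool\<close>, second
  countable, as \<open>condensation_points\<close> requires of the codomain of
  \<open>g\<close>.\<close>

instance bool :: second_countable_topology
proof
  show "\<exists>B::bool set set. countable B \<and> open = generate_topology B"
    by (intro exI[of _ "range lessThan \<union> range greaterThan"])
      (auto simp: open_bool_def)
qed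

text \<open>Tychonoff's theorem with finite factors.\<close>

lemma compact_UNIV_fun_bool: "compact (UNIV :: ('i \<Rightarrow> bool) set)"
proof -
  have "compact_space (product_topology (\<lambda>i::'i. euclidean :: bool topology) UNIV)"
    by (subst compact_space_product_topology) (simp add: compact_space_def finite_imp_compact)
  then show ?thesis
    by (simp add: euclidean_product_topology compact_space_def)
qed

text \<open>The function type is an instance of \<open>t2_space\<close> only for metric codomains, and \<^typ>\<open>bool\<close>
  is not an instance of \<^class>\<open>metric_space\<close>.\<close>

lemma Hausdorff_space_euclidean_fun_bool: "Hausdorff_space (euclidean :: ('i \<Rightarrow> bool) topology)"
proof -
  have "Hausdorff_space (euclidean :: bool topology)"
    unfolding Hausdorff_space_def disjnt_def using hausdorff by (metis open_openin)
  then show ?thesis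
    by (metis Hausdorff_space_product_topology euclidean_product_topology)
qed

lemma uncountable_UNIV_cantor: "uncountable (UNIV :: cantor set)"
proof
  assume "countable (UNIV :: cantor set)"
  then obtain f :: "cantor \<Rightarrow> nat" where "inj f"
    by (auto simp: countable_def)
  then have "surj (inv f)"
    by (rule inj_imp_surj_inv)
  then obtain n where "inv f n = (\<lambda>m. \<not> inv f m m)"
    by (metis surjD)
  from fun_cong[OF this, of n] show False
    by simp
qed

text \<open>Well-order the type and let \<open>W\<close> collect the points with countably many
  predecessors. Were \<open>W\<close> countable, the least point outside it would have all its
  proper predecessors in \<open>W\<close>, hence only countably many, and so would lie in
  \<open>W\<close>.\<close>

lemma uncountable_total_countable_segments:
  assumes "uncountable (UNIV :: 'a set)"
  obtains W :: "'a set" and r :: "'a rel" where "uncountable W"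
    "\<And>x y. x \<in> W \<Longrightarrow> y \<in> W \<Longrightarrow> (x, y) \<in> r \<or> (y, x) \<in> r"
    "\<And>y. y \<in> W \<Longrightarrow> countable {x \<in> W. (x, y) \<in> r}"
proof -
  obtain r :: "'a rel" where r: "Well_order r" "Field r = UNIV"
    using well_ordering by (elim exE conjE)
  define W where "W = {y. countable {x. (x, y) \<in> r}}"
  have "uncountable W"
  proof
    assume W: "countable W"
    then have "- W \<noteq> {}"
      using assms by (metis Compl_UNIV_eq double_complement)
    moreover have "wf (r - Id)" "total r" "refl r"
      using r by (auto simp: well_order_on_def linear_order_on_def partial_order_on_def preorder_on_def)
    ultimately obtain m where m: "m \<in> - W" "\<And>x. (x, m) \<in> r - Id \<Longrightarrow> x \<in> W"
      by (metis ComplI ex_in_conv wfE_min)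
    then have "{x. (x, m) \<in> r} \<subseteq> insert m W"
      by auto
    then have "countable {x. (x, m) \<in> r}"
      using W by (meson countable_insert countable_subset)
    with m(1) show False
      by (simp add: W_def)
  qed
  moreover have "(x, y) \<in> r \<or> (y, x) \<in> r" for x y
    using r by (cases "x = y") (auto simp: well_order_on_def linear_order_on_def partial_order_on_def
        preorder_on_def total_on_def refl_on_def)
  moreover have "countable {x \<in> W. (x, y) \<in> r}" if "y \<in> W" for y
    using that by (auto simp: W_def intro: countable_subset)
  ultimately show thesis
    by (rule that)
qed

text \<open>Only countably many basic open sets have countable preimage in \<open>W\<close>, so the
  union \<open>N\<close> of these preimages is countable and \<open>W - N\<close> serves as
  \<open>Y\<close>. Since \<open>g\<close> is arbitrary, uncountability is counted in its
  domain.\<close>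

lemma condensation_points:
  fixes g :: "'a \<Rightarrow> 'b::second_countable_topology"
  assumes "uncountable W"
  obtains Y where "Y \<subseteq> W" "Y \<noteq> {}"
    "\<And>U y. open U \<Longrightarrow> y \<in> Y \<Longrightarrow> g y \<in> U \<Longrightarrow> uncountable {x \<in> Y. g x \<in> U}"
proof -
  obtain B :: "'b set set" where B: "countable B" "topological_basis B"
    using ex_countable_basis by blast
  define N where "N = (\<Union>b \<in> {b \<in> B. countable {x \<in> W. g x \<in> b}}. {x \<in> W. g x \<in> b})"
  have N: "countable N"
    unfolding N_def using B(1) by (intro countable_UN) (auto intro: countable_subset)
  have "uncountable {x \<in> W - N. g x \<in> U}" if U: "open U" "y \<in> W - N" "g y \<in> U" for U y
  proof
    assume *: "countable {x \<in> W - N. g x \<in> U}"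
    obtain b where b: "b \<in> B" "g y \<in> b" "b \<subseteq> U"
      using topological_basisE[OF B(2) U(1,3)] by blast
    have "{x \<in> W. g x \<in> b} \<subseteq> {x \<in> W - N. g x \<in> U} \<union> N"
      using b by blast
    then have "countable {x \<in> W. g x \<in> b}"
      using * N by (meson countable_Un countable_subset)
    then show False
      using b U(2) by (auto simp: N_def)
  qed
  moreover have "W - N \<noteq> {}"
    using assms N by (metis Diff_eq_empty_iff countable_subset)
  ultimately show thesis
    using that[of "W - N"] by blast
qed

text \<open>Both \<open>D\<close> and \<open>- D\<close> are countable unions of closed sets. Their
  traces cover \<open>K\<close>, so by Baire one trace has nonempty interior relative to
  \<open>K\<close>.\<close>

lemma delta_0_2_resolvable:
  fixes K :: "'a::topological_space set"
  assumes "Hausdorff_space (euclidean :: 'a topology)" "compact K" "K \<noteq> {}" "delta_0_2 D"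
  obtains U where "open U" "U \<inter> K \<noteq> {}" "U \<inter> K \<subseteq> D \<or> U \<inter> K \<subseteq> - D"
proof -
  have "fsigma D" "fsigma (- D)"
    using assms(4) by (auto simp: delta_0_2_def intro: gdelta_imp_fsigma)
  obtain C :: "nat \<Rightarrow> 'a set" where C: "\<And>n. closed (C n)" "D = (\<Union>n. C n)"
    using \<open>fsigma D\<close> by cases (rule that)
  obtain E :: "nat \<Rightarrow> 'a set" where E: "\<And>n. closed (E n)" "- D = (\<Union>n. E n)"
    using \<open>fsigma (- D)\<close> by cases (rule that)
  define \<G> where "\<G> = range (\<lambda>n. K \<inter> C n) \<union> range (\<lambda>n. K \<inter> E n)"
  have "\<Union>\<G> = K \<inter> (\<Union>n. C n) \<union> K \<inter> (\<Union>n. E n)"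
    unfolding \<G>_def by blast
  also have "\<dots> = K \<inter> D \<union> K \<inter> - D"
    by (simp only: C(2)[symmetric] E(2)[symmetric])
  finally have "\<Union>\<G> = K \<inter> D \<union> K \<inter> - D" .
  then have "\<Union>\<G> = K"
    by blast
  then have "top_of_set K interior_of \<Union>\<G> \<noteq> {}"
    using assms(3) interior_of_topspace[of "top_of_set K"] by simp
  moreover have "locally_compact_space (top_of_set K) \<and> regular_space (top_of_set K)"
  proof -
    have "compact_space (top_of_set K)"
      using assms(2) by (simp add: compact_space_subtopology)
    moreover have "Hausdorff_space (top_of_set K)"
      by (intro Hausdorff_space_subtopology assms(1))
    ultimately show ?thesis
      by (simp add: compact_Hausdorff_imp_regular_space compact_imp_locally_compact_space)
  qed
  moreover have "countable \<G>"
    by (simp add: \<G>_def)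
  ultimately obtain T where T: "T \<in> \<G>" "\<not> (closedin (top_of_set K) T \<and> top_of_set K interior_of T = {})"
    using Baire_category_alt[of "top_of_set K" \<G>] by blast
  have "closedin (top_of_set K) T"
    using T(1) C(1) E(1) by (auto simp: \<G>_def intro: closedin_closed_Int)
  with T obtain x where "x \<in> top_of_set K interior_of T"
    by blast
  then obtain S where S: "openin (top_of_set K) S" "x \<in> S" "S \<subseteq> T"
    by (auto simp: interior_of_def)
  then obtain U where "open U" "S = K \<inter> U"
    by (auto simp: openin_open)
  moreover have "T \<subseteq> D \<or> T \<subseteq> - D"
  proof -
    have "T \<subseteq> (\<Union>n. C n) \<or> T \<subseteq> (\<Union>n. E n)"
      using T(1) unfolding \<G>_def by blast
    then show ?thesis
      by (simp only: C(2)[symmetric] E(2)[symmetric])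
  qed
  ultimately show thesis
    using that[of U] S by blast
qed

theorem proposition2p7:
  fixes F :: "cantor \<times> cantor \<Rightarrow> cantor"
  assumes "universal F"
  shows "\<not> baire_class_1 F"
proof
  assume "baire_class_1 F"
  obtain W and r :: "cantor rel" where W: "uncountable W" "\<And>x y. x \<in> W \<Longrightarrow> y \<in> W \<Longrightarrow> (x, y) \<in> r \<or> (y, x) \<in> r"
    and seg: "\<And>y. y \<in> W \<Longrightarrow> countable {x \<in> W. (x, y) \<in> r}"
    by (rule uncountable_total_countable_segments[OF uncountable_UNIV_cantor]) (rule that)
  \<comment> \<open>The relation is coded by constant sequences, so a single coordinate of
    \<open>F\<close> decides it.\<close>
  have "\<exists>g. \<forall>x y. (\<lambda>(x, y) n. (x, y) \<in> r) (x, y) = F (g x, g y)"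
    using assms unfolding universal_def by blast
  then obtain g where g: "\<And>x y. F (g x, g y) = (\<lambda>n. (x, y) \<in> r)"
    by (auto simp: fun_eq_iff)
  define D where "D = F -` {z. z 0}"
  have gD: "(g x, g y) \<in> D \<longleftrightarrow> (x, y) \<in> r" for x y
    by (simp add: D_def g)
  have "continuous_on UNIV (\<lambda>z::cantor. z 0)"
    by (rule continuous_on_product_then_coordinatewise[OF continuous_on_id])
  then have "open ((\<lambda>z::cantor. z 0) -` {True})" "closed ((\<lambda>z::cantor. z 0) -` {True})"
    by (simp_all add: open_vimage closed_vimage open_discrete finite_imp_closed)
  moreover have "(\<lambda>z::cantor. z 0) -` {True} = {z. z 0}"
    by auto
  ultimately have "delta_0_2 D"
    using \<open>baire_class_1 F\<close> unfolding baire_class_1_def D_def by metis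
  obtain Y where Y: "Y \<subseteq> W" "Y \<noteq> {}"
    "\<And>U y. open U \<Longrightarrow> y \<in> Y \<Longrightarrow> g y \<in> U \<Longrightarrow> uncountable {x \<in> Y. g x \<in> U}"
    by (rule condensation_points[OF W(1), of g]) (rule that)
  \<comment> \<open>Taking the closure gives a compact set for the Baire argument, while every open
    set that meets \<open>K\<close> still meets \<open>g\<close> Y \<times> g
    \<open>Y\<close>.\<close>
  define K where "K = closure (g ` Y \<times> g ` Y)"
  have "compact (UNIV \<times> UNIV :: (cantor \<times> cantor) set)"
    by (intro compact_Times compact_UNIV_fun_bool)
  then have "compact (UNIV \<inter> K)"
    unfolding K_def by (intro compact_Int_closed) auto
  then have "compact K"
    by simp
  have gY: "g ` Y \<times> g ` Y \<subseteq> K"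
    by (simp add: K_def closure_subset)
  then have "K \<noteq> {}"
    using Y(2) by auto
  have H: "Hausdorff_space (euclidean :: (cantor \<times> cantor) topology)"
    by (metis Hausdorff_space_euclidean_fun_bool Hausdorff_space_prod_topology prod_topology_euclidean)
  obtain Q where Q: "open Q" "Q \<inter> K \<noteq> {}" "Q \<inter> K \<subseteq> D \<or> Q \<inter> K \<subseteq> - D"
    by (rule delta_0_2_resolvable[OF H \<open>compact K\<close> \<open>K \<noteq> {}\<close> \<open>delta_0_2 D\<close>]) (rule that)
  then have "Q \<inter> (g ` Y \<times> g ` Y) \<noteq> {}"
    by (simp only: K_def open_Int_closure_eq_empty) simp
  then obtain a b where ab: "a \<in> Y" "b \<in> Y" "(g a, g b) \<in> Q"
    by blast
  obtain U V where UV: "open U" "open V" "g a \<in> U" "g b \<in> V" "U \<times> V \<subseteq> Q"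
    using open_prod_elim[OF Q(1) ab(3)] by (metis mem_Sigma_iff)
  define A B where "A = {x \<in> Y. g x \<in> U}" and "B = {y \<in> Y. g y \<in> V}"
  have AB: "A \<subseteq> W" "B \<subseteq> W" "uncountable A" "uncountable B" "a \<in> A" "b \<in> B"
    using Y ab UV by (auto simp: A_def B_def)
  have "(g x, g y) \<in> Q \<inter> K" if "x \<in> A" "y \<in> B" for x y
    using that UV(5) gY by (auto simp: A_def B_def)
  then have "(\<forall>x\<in>A. \<forall>y\<in>B. (x, y) \<in> r) \<or> (\<forall>x\<in>A. \<forall>y\<in>B. (x, y) \<notin> r)"
    using Q(3) gD by blast
  then show False
  proof
    assume "\<forall>x\<in>A. \<forall>y\<in>B. (x, y) \<in> r"
    then have "A \<subseteq> {x \<in> W. (x, b) \<in> r}"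
      using AB by blast
    then show False
      using AB seg countable_subset by blast
  next
    assume *: "\<forall>x\<in>A. \<forall>y\<in>B. (x, y) \<notin> r"
    \<comment> \<open>Totality on \<open>W\<close> turns the failure of \<open>r\<close> on
      \<open>A \<times> B\<close> into the reverse relation, so \<open>B\<close> falls into the
      initial segment of \<open>a\<close>.\<close>
    have "(y, a) \<in> r" if "y \<in> B" for y
      using * that AB W(2)[of a y] by blast
    then have "B \<subseteq> {y \<in> W. (y, a) \<in> r}"
      using AB by blast
    then show False
      using AB seg countable_subset by blast
  qed
qed

end
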